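(* Let $G=(V,E)$ be a strongly connected digraph with $V=\{1,\dots,N\}$ and $d_j\ge2$ for every $j\in V$, and let $i\in V$ be a vertex such that some directed circuit of $G$ does not pass through $i$. Let $0<\delta<\min_{j\in V}\frac1{d_j-1}$ and let $x\in\mathcal{A}(\delta)$ (defined in the context) be such that for every vertex $j\ne i$ in $V$ there are integers $m_j,n_j\in[1,d_j-1]$ with $$|x_i^{(1)}|\in\big(|x_j^{(1)}|+\cdots+|x_j^{(m_j)}|+(m_j-1)\delta,\ |x_j^{(1)}|+\cdots+|x_j^{(m_j)}|+m_j\delta\big),$$ $$1-|x_i^{(1)}|\in\big(|x_j^{(1)}|+\cdots+|x_j^{(n_j)}|+(n_j-1)\delta,\ |x_j^{(1)}|+\cdots+|x_j^{(n_j)}|+n_j\delta\big).$$ Let $\digamma(x)$ be the corresponding GD-IFS (defined in the context; it satisfies the CSSC), with attractors $(F_j)_{j\in V}$. Then $F_i$ is not the attractor of any standard IFS on $\mathbb{R}$.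
   Context: **Digraphs.** A digraph $G=(V,E)$ has finitely many vertices and directed edges (loops and multiple edges allowed). $E_{uv}$ is the set of edges from $u$ to $v$, $\omega(e)$ is the terminal vertex of the edge $e$, and $d_u$ is the number of edges leaving $u$. A directed path is a finite sequence $e_1\cdots e_k$ ($k\ge1$) of edges with the terminal vertex of $e_i$ equal to the initial vertex of $e_{i+1}$; a directed circuit is a directed path whose initial and terminal vertices coincide. $G$ is strongly connected if for all $u,v\in V$ (including $u=v$) there is a directed path from $u$ to $v$. **GD-IFS.** A GD-IFS on $\mathbb{R}$ based on $G$ is a family $(S_e)_{e\in E}$ of contracting similarities of $\mathbb{R}$ with ratios in $(-1,1)\setminus\{0\}$. Its attractors are the unique nonempty compact sets $(F_u)_{u\in V}$ with $F_u=\bigcup_{v\in V}\bigcup_{e\in E_{uv}}S_e(F_v)$ for all $u\in V$. It satisfies the CSSC (convex strong separation condition) if for each $u\in V$ the union $\bigcup_{v\in V}\bigcup_{e\in E_{uv}}S_e(\mathrm{conv}\,F_v)$ is disjoint. **Standard IFS.** A standard IFS on $\mathbb{R}$ is a finite set of distinct contracting similarities $\{f_i\}$ of $\mathbb{R}$ (ratios in $(-1,1)\setminus\{0\}$), with no separation condition assumed; its attractor is the unique nonempty compact $K$ with $K=\bigcup_i f_i(K)$. **$\mathcal{A}(\delta)$ and $\digamma(x)$.** For each $i\in V$ fix an ordering $e_i(1),\dots,e_i(d_i)$ of the edges leaving $i$. With $n=2\#E-\#V$, $\mathcal{A}(\delta)$ is the set of vectors $$x=(x_1^{(1)},\dots,x_1^{(d_1)},\dots,x_N^{(1)},\dots,x_N^{(d_N)},\delta,\dots,\delta)\in\mathbb{R}^n$$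 (with $\#E-\#V$ final entries $\delta$) such that $|x_i^{(k)}|>0$ and $|x_i^{(1)}|+\cdots+|x_i^{(d_i)}|=1-(d_i-1)\delta$ for all $i\in V$, $1\le k\le d_i$. For $x\in\mathcal{A}(\delta)$ put $b_i^{(1)}=0$ and $b_i^{(k+1)}=b_i^{(k)}+|x_i^{(k)}|+\delta$ ($i\in V$, $1\le k\le d_i-1$), and let $\digamma(x)=\{S_{e_i(k)}:i\in V,1\le k\le d_i\}$ with $$S_{e_i(k)}(t)=x_i^{(k)}t+b_i^{(k)}-x_i^{(k)}\mathbf{1}_{\{x_i^{(k)}<0\}}\qquad(t\in\mathbb{R}),$$ where $\mathbf{1}_{\{x_i^{(k)}<0\}}$ is $1$ if $x_i^{(k)}<0$ and $0$ otherwise. *)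

theory Defs
  imports Complex_Main "Graph_Theory.Digraph" "Graph_Theory.Arc_Walk"
begin

text \<open>
  A digraph is a \<open>fin_digraph\<close> (loops and parallel arcs are allowed) whose vertices are
  natural numbers; \<^const>\<open>head\<close> is the terminal-vertex map and \<^const>\<open>out_degree\<close> gives the
  numbers \<open>d\<^sub>u\<close>.
\<close>

definition directed_path :: "('v, 'e) pre_digraph \<Rightarrow> 'v \<Rightarrow> 'e list \<Rightarrow> 'v \<Rightarrow> bool" where
  "directed_path G u p v \<longleftrightarrow> pre_digraph.awalk G u p v \<and> p \<noteq> []"

text \<open>
  The library's \<open>strongly_connected\<close> admits the empty walk from a vertex to itself; here a
  path of length at least one is required also for \<open>u = v\<close>.
\<close>

definition strongly_conn :: "('v, 'e) pre_digraph \<Rightarrow> bool" where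
  "strongly_conn G \<longleftrightarrow> (\<forall>u\<in>verts G. \<forall>v\<in>verts G. \<exists>p. directed_path G u p v)"

definition circuit_avoiding :: "('v, 'e) pre_digraph \<Rightarrow> 'v \<Rightarrow> bool" where
  "circuit_avoiding G i \<longleftrightarrow>
    (\<exists>u p. directed_path G u p u \<and> i \<notin> set (pre_digraph.awalk_verts G u p))"

definition contracting_similarity :: "(real \<Rightarrow> real) \<Rightarrow> bool" where
  "contracting_similarity f \<longleftrightarrow>
    (\<exists>r c. r \<in> {-1<..<1} - {0} \<and> f = (\<lambda>t. r * t + c))"

definition standard_ifs :: "(real \<Rightarrow> real) set \<Rightarrow> bool" where
  "standard_ifs \<Phi> \<longleftrightarrow> finite \<Phi> \<and> (\<forall>f\<in>\<Phi>. contracting_similarity f)"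

definition ifs_attractor :: "(real \<Rightarrow> real) set \<Rightarrow> real set \<Rightarrow> bool" where
  "ifs_attractor \<Phi> K \<longleftrightarrow> K \<noteq> {} \<and> compact K \<and> K = (\<Union>f\<in>\<Phi>. f ` K)"

definition edges_between :: "('v, 'e) pre_digraph \<Rightarrow> 'v \<Rightarrow> 'v \<Rightarrow> 'e set" where
  "edges_between G u v = {a \<in> arcs G. tail G a = u \<and> head G a = v}"

definition gd_attractors ::
  "('v, 'e) pre_digraph \<Rightarrow> ('e \<Rightarrow> real \<Rightarrow> real) \<Rightarrow> ('v \<Rightarrow> real set) \<Rightarrow> bool" where
  "gd_attractors G S F \<longleftrightarrow>
    (\<forall>u\<in>verts G. F u \<noteq> {} \<and> compact (F u) \<and>
       F u = (\<Union>v\<in>verts G. \<Union>a\<in>edges_between G u v. S a ` F v))"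

definition edge_ordering :: "('v, 'e) pre_digraph \<Rightarrow> ('v \<Rightarrow> nat \<Rightarrow> 'e) \<Rightarrow> bool" where
  "edge_ordering G \<epsilon> \<longleftrightarrow>
    (\<forall>i\<in>verts G. bij_betw (\<epsilon> i) {1..out_degree G i} (out_arcs G i))"

text \<open>
  For \<open>verts G = {1..N}\<close>, a vector in \<open>\<real>\<^sup>n\<close> is a list of length \<open>n\<close>. The entry
  \<open>x\<^sub>i\<^sup>(\<^sup>k\<^sup>)\<close> (with \<open>i\<close> and \<open>k\<close> counted from 1) is preceded by the blocks of the vertices
  \<open>1, \<dots>, i - 1\<close>, of lengths \<open>d\<^sub>1, \<dots>, d\<^bsub>i-1\<^esub>\<close>, and by \<open>k - 1\<close> entries of its own block.
\<close>

definition entry :: "(nat, 'e) pre_digraph \<Rightarrow> real list \<Rightarrow> nat \<Rightarrow> nat \<Rightarrow> real" where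
  "entry G x i k = x ! ((\<Sum>j=1..<i. out_degree G j) + (k - 1))"

definition param_set :: "(nat, 'e) pre_digraph \<Rightarrow> real \<Rightarrow> real list set" where
  "param_set G \<delta> =
    {x. length x = 2 * card (arcs G) - card (verts G) \<and>
        (\<forall>l. card (arcs G) \<le> l \<and> l < length x \<longrightarrow> x ! l = \<delta>) \<and>
        (\<forall>i\<in>verts G. \<forall>k\<in>{1..out_degree G i}. \<bar>entry G x i k\<bar> > 0) \<and>
        (\<forall>i\<in>verts G. (\<Sum>k=1..out_degree G i. \<bar>entry G x i k\<bar>)
                        = 1 - (real (out_degree G i) - 1) * \<delta>)}"

text \<open>\<open>offset G \<delta> x i k\<close> is \<open>b\<^sub>i\<^sup>(\<^sup>k\<^sup>)\<close> for \<open>k \<ge> 1\<close>; the value at \<open>k = 0\<close> is a dummy.\<close>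

primrec offset :: "(nat, 'e) pre_digraph \<Rightarrow> real \<Rightarrow> real list \<Rightarrow> nat \<Rightarrow> nat \<Rightarrow> real" where
  "offset G \<delta> x i 0 = 0"
| "offset G \<delta> x i (Suc k) =
    (if k = 0 then 0 else offset G \<delta> x i k + \<bar>entry G x i k\<bar> + \<delta>)"

text \<open>
  The family is indexed by the arcs: \<open>a\<close> is \<open>\<epsilon> i k\<close> for \<open>i = tail G a\<close> and a unique
  \<open>k \<in> {1..d\<^sub>i}\<close>.
\<close>

definition digamma_ifs ::
  "(nat, 'e) pre_digraph \<Rightarrow> (nat \<Rightarrow> nat \<Rightarrow> 'e) \<Rightarrow> real \<Rightarrow> real list \<Rightarrow> 'e \<Rightarrow> real \<Rightarrow> real" where
  "digamma_ifs G \<epsilon> \<delta> x a t =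
    (let i = tail G a;
         k = inv_into {1..out_degree G i} (\<epsilon> i) a
     in entry G x i k * t + offset G \<delta> x i k
          - entry G x i k * (if entry G x i k < 0 then 1 else 0))"

end

theory Submission imports Defs "HOL-Analysis.Analysis" begin

text \<open>
  Every \<open>F\<^sub>u\<close> has convex hull \<open>[0, 1]\<close>, and its longest gaps are the first-level ones, all of the
  same length \<open>\<delta>\<close> for all vertices. This makes an affine copy of \<open>F\<^sub>i\<close> inside some \<open>F\<^sub>u\<close> rigid:
  if its ratio is less than 1 in modulus, its gaps are shorter than \<open>\<delta>\<close>, so it cannot reach across
  a first-level gap of \<open>F\<^sub>u\<close> and lies in one first-level interval (\<open>affine_copy_in_interval\<close>).
  Undoing the similarity of the corresponding edge gives a larger affine copy of \<open>F\<^sub>i\<close> in another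
  attractor, and the step can be repeated until the ratio is \<open>\<plusminus>1\<close>. Hence a similarity \<open>f\<close> with
  \<open>f(F\<^sub>i) \<subseteq> F\<^sub>i\<close> is \<open>S\<^sub>p \<circ> g\<close>, where \<open>S\<^sub>p\<close> is the composition of the similarities along a walk \<open>p\<close> from
  \<open>i\<close> to some \<open>v\<close>, and \<open>g\<close> is the identity or \<open>t \<mapsto> 1 - t\<close>, with \<open>g(F\<^sub>i) \<subseteq> F\<^sub>v\<close>
  (\<open>affine_copy_descent\<close>).

  The number \<open>\<bar>x\<^sub>i\<^sup>(\<^sup>1\<^sup>)\<bar>\<close> is the right end of the first interval at \<open>i\<close> and so belongs to \<open>F\<^sub>i\<close>. The
  hypothesis puts it and its mirror image into gaps of \<open>F\<^sub>j\<close> for every \<open>j \<noteq> i\<close>, which forces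
  \<open>v = i\<close>: each map of a standard IFS with attractor \<open>F\<^sub>i\<close> sends \<open>F\<^sub>i\<close> into the cylinder of a nonempty
  closed walk at \<open>i\<close> (\<open>self_copy_closed_walk\<close>). Finitely many such cylinders do not cover \<open>F\<^sub>i\<close>. By
  strong connectivity there are arbitrarily long walks that leave \<open>i\<close>, reach the circuit avoiding
  \<open>i\<close> and wind around it, never returning to \<open>i\<close> (\<open>long_walk_without_return\<close>); since intersecting
  cylinders belong to comparable walks (\<open>word_sim_eq_imp_prefix\<close>), a cylinder of such a walk, once
  it is at least as long as all of the finitely many closed walks, misses all of theirs.
\<close>

section \<open>A contraction principle on finite sets\<close>

text \<open>
  The maximum \<open>m\<close> of \<open>h\<close> satisfies \<open>0 \<le> m \<le> \<rho> * m\<close>. Applied to distances that the similarities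
  contract, this locates the attractors directly from their invariance.
\<close>

lemma finite_contraction_zero:
  fixes h :: "'a \<Rightarrow> real"
  assumes "finite A" and "\<rho> < 1"
    and nonneg: "\<And>a. a \<in> A \<Longrightarrow> 0 \<le> h a"
    and step: "\<And>a. a \<in> A \<Longrightarrow> \<exists>b\<in>A. h a \<le> \<rho> * h b"
    and "a \<in> A"
  shows "h a = 0"
proof -
  define m where "m = Max (h ` A)"
  have fin: "finite (h ` A)" and ne: "h ` A \<noteq> {}"
    using assms by auto
  then have "m \<in> h ` A"
    unfolding m_def by (rule Max_in)
  then obtain b where b: "b \<in> A" "h b = m"
    by auto
  have max: "h b' \<le> m" if "b' \<in> A" for b'
    unfolding m_def using fin that by simp
  obtain b' where b': "b' \<in> A" "m \<le> \<rho> * h b'"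
    using step b by metis
  have "\<rho> * h b' \<le> h b'"
    using mult_right_mono[of \<rho> 1 "h b'"] nonneg[OF b'(1)] \<open>\<rho> < 1\<close> by simp
  then have "h b' = m"
    using b'(2) max[OF b'(1)] by linarith
  then have "(1 - \<rho>) * m \<le> 0"
    using b'(2) by (simp add: algebra_simps)
  then have "m \<le> 0"
    using \<open>\<rho> < 1\<close> by (simp add: mult_le_0_iff)
  then show ?thesis
    using max[OF \<open>a \<in> A\<close>] nonneg[OF \<open>a \<in> A\<close>] by linarith
qed

section \<open>Graph-directed systems on chains of intervals\<close>

text \<open>
  The edges leaving \<open>u\<close> map \<open>[0, 1]\<close> onto consecutive intervals \<open>[lo u k, hi u k]\<close> that start at 0,
  end at 1 and are separated by gaps of the common length \<open>\<delta>\<close>. The orientation of each map is left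
  open by \<open>ends\<close>, so that the signs of the ratios do not have to be distinguished later.
\<close>

locale interval_chain_ifs = fin_digraph G for G :: "('v, 'e) pre_digraph" +
  fixes \<epsilon> :: "'v \<Rightarrow> nat \<Rightarrow> 'e" and r c :: "'e \<Rightarrow> real"
    and lo hi :: "'v \<Rightarrow> nat \<Rightarrow> real" and \<delta> :: real and F :: "'v \<Rightarrow> real set"
  assumes ordering: "edge_ordering G \<epsilon>"
    and degree: "u \<in> verts G \<Longrightarrow> 1 \<le> out_degree G u"
    and gap_pos: "0 < \<delta>"
    and ratio: "a \<in> arcs G \<Longrightarrow> 0 < \<bar>r a\<bar> \<and> \<bar>r a\<bar> < 1"
    and lo_less_hi: "u \<in> verts G \<Longrightarrow> k \<in> {1..out_degree G u} \<Longrightarrow> lo u k < hi u k"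
    and lo_first: "u \<in> verts G \<Longrightarrow> lo u 1 = 0"
    and hi_last: "u \<in> verts G \<Longrightarrow> hi u (out_degree G u) = 1"
    and lo_Suc: "u \<in> verts G \<Longrightarrow> 1 \<le> k \<Longrightarrow> k < out_degree G u \<Longrightarrow> lo u (Suc k) = hi u k + \<delta>"
    and ends: "u \<in> verts G \<Longrightarrow> k \<in> {1..out_degree G u} \<Longrightarrow>
        c (\<epsilon> u k) = lo u k \<and> r (\<epsilon> u k) + c (\<epsilon> u k) = hi u k \<or>
        c (\<epsilon> u k) = hi u k \<and> r (\<epsilon> u k) + c (\<epsilon> u k) = lo u k"
    and F_nonempty: "u \<in> verts G \<Longrightarrow> F u \<noteq> {}"
    and F_compact: "u \<in> verts G \<Longrightarrow> compact (F u)"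
    and F_invariant: "u \<in> verts G \<Longrightarrow> F u = (\<Union>a\<in>out_arcs G u. (\<lambda>t. r a * t + c a) ` F (head G a))"
begin

abbreviation deg :: "'v \<Rightarrow> nat" where "deg \<equiv> out_degree G"

definition sim :: "'e \<Rightarrow> real \<Rightarrow> real" where "sim a t = r a * t + c a"

definition word_sim :: "'e list \<Rightarrow> real \<Rightarrow> real" where "word_sim p = foldr sim p"

lemma word_sim_simps [simp]:
  "word_sim [] t = t" "word_sim (a # p) t = sim a (word_sim p t)"
  by (simp_all add: word_sim_def)

section \<open>First-level intervals\<close>

lemma edge_arc:
  assumes "u \<in> verts G" "k \<in> {1..deg u}"
  shows "\<epsilon> u k \<in> out_arcs G u" "\<epsilon> u k \<in> arcs G" "tail G (\<epsilon> u k) = u" "head G (\<epsilon> u k) \<in> verts G"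
proof -
  show *: "\<epsilon> u k \<in> out_arcs G u"
    using ordering assms unfolding edge_ordering_def bij_betw_def by blast
  then show "\<epsilon> u k \<in> arcs G" "tail G (\<epsilon> u k) = u" "head G (\<epsilon> u k) \<in> verts G"
    by auto
qed

lemma arc_edge:
  assumes "a \<in> arcs G"
  obtains k where "k \<in> {1..deg (tail G a)}" "a = \<epsilon> (tail G a) k"
proof -
  have "a \<in> out_arcs G (tail G a)" "tail G a \<in> verts G"
    using assms by auto
  then have "a \<in> \<epsilon> (tail G a) ` {1..deg (tail G a)}"
    using ordering unfolding edge_ordering_def bij_betw_def by blast
  then show ?thesis
    using that by blast
qed

lemma hi_lo_separated:
  assumes "u \<in> verts G" "1 \<le> k" "k < m" "m \<le> deg u"
  shows "hi u k + \<delta> \<le> lo u m"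
  using \<open>k < m\<close> \<open>m \<le> deg u\<close>
proof (induction m)
  case (Suc m)
  show ?case
  proof (cases "k = m")
    case True
    then show ?thesis
      using Suc.prems assms lo_Suc[of u m] by simp
  next
    case False
    then have "hi u k + \<delta> \<le> lo u m"
      using Suc by simp
    then show ?thesis
      using False Suc.prems assms lo_Suc[of u m] lo_less_hi[of u m] gap_pos by simp
  qed
qed simp

lemma lo_nonneg: "u \<in> verts G \<Longrightarrow> k \<in> {1..deg u} \<Longrightarrow> 0 \<le> lo u k"
  using hi_lo_separated[of u 1 k] lo_first[of u] lo_less_hi[of u 1] gap_pos
  by (cases "k = 1") auto

lemma hi_le_1: "u \<in> verts G \<Longrightarrow> k \<in> {1..deg u} \<Longrightarrow> hi u k \<le> 1"
  using hi_lo_separated[of u k "deg u"] hi_last[of u] lo_less_hi[of u "deg u"] gap_pos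
  by (cases "k = deg u") auto

lemma sim_in_interval:
  assumes "u \<in> verts G" "k \<in> {1..deg u}" "t \<in> {0..1}"
  shows "sim (\<epsilon> u k) t \<in> {lo u k..hi u k}"
proof -
  define A B where "A = c (\<epsilon> u k)" and "B = r (\<epsilon> u k) + c (\<epsilon> u k)"
  have "sim (\<epsilon> u k) t = (1 - t) * A + t * B"
    by (simp add: sim_def A_def B_def algebra_simps)
  moreover have "A \<in> {lo u k..hi u k}" "B \<in> {lo u k..hi u k}"
    using ends[OF assms(1,2)] lo_less_hi[OF assms(1,2)] by (auto simp: A_def B_def)
  ultimately show ?thesis
    using convexD[OF convex_real_interval(5), of A "lo u k" "hi u k" B "1 - t" t] assms(3) by simp
qed

lemma interval_eq_sim:
  assumes "u \<in> verts G" "k \<in> {1..deg u}" "y \<in> {lo u k..hi u k}"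
  obtains t where "t \<in> {0..1}" "y = sim (\<epsilon> u k) t"
proof
  let ?a = "\<epsilon> u k"
  have "r ?a \<noteq> 0"
    using ratio[OF edge_arc(2)[OF assms(1,2)]] by auto
  then show "y = sim ?a ((y - c ?a) / r ?a)"
    by (simp add: sim_def)
  show "(y - c ?a) / r ?a \<in> {0..1}"
  proof (rule disjE[OF ends[OF assms(1,2)]])
    assume "c ?a = lo u k \<and> r ?a + c ?a = hi u k"
    then have "0 < r ?a" "0 \<le> y - c ?a" "y - c ?a \<le> r ?a"
      using lo_less_hi[OF assms(1,2)] assms(3) by auto
    then show ?thesis
      by simp
  next
    assume "c ?a = hi u k \<and> r ?a + c ?a = lo u k"
    then have "r ?a < 0" "y - c ?a \<le> 0" "r ?a \<le> y - c ?a"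
      using lo_less_hi[OF assms(1,2)] assms(3) by auto
    then show ?thesis
      by (simp add: divide_nonpos_neg)
  qed
qed

lemma sim_inj: "a \<in> arcs G \<Longrightarrow> sim a s = sim a t \<Longrightarrow> s = t"
  using ratio[of a] by (auto simp: sim_def)

lemma sim_unit:
  assumes "a \<in> arcs G" "t \<in> {0..1}"
  shows "sim a t \<in> {0..1}"
proof -
  obtain k where k: "k \<in> {1..deg (tail G a)}" "a = \<epsilon> (tail G a) k"
    using arc_edge assms by blast
  have u: "tail G a \<in> verts G"
    using assms by simp
  show ?thesis
    using sim_in_interval[OF u k(1) assms(2)] lo_nonneg[OF u k(1)] hi_le_1[OF u k(1)] k(2) by auto
qed

lemma intervals_disjoint:
  assumes "u \<in> verts G" "k \<in> {1..deg u}" "m \<in> {1..deg u}"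
    and "y \<in> {lo u k..hi u k}" "y \<in> {lo u m..hi u m}"
  shows "k = m"
  using hi_lo_separated[of u k m] hi_lo_separated[of u m k] assms gap_pos
  by (cases k m rule: linorder_cases) auto

lemma sim_eq_imp_arc_eq:
  assumes "a \<in> arcs G" "b \<in> arcs G" "tail G a = tail G b"
    and "s \<in> {0..1}" "t \<in> {0..1}" "sim a s = sim b t"
  shows "a = b"
proof -
  obtain k where k: "k \<in> {1..deg (tail G a)}" "a = \<epsilon> (tail G a) k"
    using arc_edge assms by blast
  obtain m where m: "m \<in> {1..deg (tail G b)}" "b = \<epsilon> (tail G b) m"
    using arc_edge assms by blast
  have "k = m"
    using intervals_disjoint[of "tail G a" k m "sim a s"] k m assms
      sim_in_interval[of "tail G a" k s] sim_in_interval[of "tail G b" m t] by auto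
  then show ?thesis
    using k m assms by simp
qed

lemma uniform_ratio:
  obtains \<rho> where "0 < \<rho>" "\<rho> < 1" "\<And>a. a \<in> arcs G \<Longrightarrow> \<bar>r a\<bar> \<le> \<rho>"
proof
  let ?A = "insert (1/2) ((\<lambda>a. \<bar>r a\<bar>) ` arcs G)"
  have fin: "finite ?A"
    by simp
  then show "Max ?A < 1"
    using ratio by (subst Max_less_iff) auto
  have "1/2 \<le> Max ?A"
    using fin by (intro Max_ge) auto
  then show "0 < Max ?A"
    by linarith
  show "\<bar>r a\<bar> \<le> Max ?A" if "a \<in> arcs G" for a
    using fin that by (intro Max_ge) auto
qed

section \<open>Position of the attractors in the unit interval\<close>

lemma sim_F: "a \<in> arcs G \<Longrightarrow> t \<in> F (head G a) \<Longrightarrow> sim a t \<in> F (tail G a)"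
  using F_invariant[of "tail G a"] by (auto simp: sim_def)

lemma F_cases:
  assumes "u \<in> verts G" "y \<in> F u"
  obtains k t where "k \<in> {1..deg u}" "t \<in> F (head G (\<epsilon> u k))" "y = sim (\<epsilon> u k) t"
proof -
  obtain a t where a: "a \<in> out_arcs G u" "t \<in> F (head G a)" "y = sim a t"
    using assms F_invariant[of u] by (auto simp: sim_def)
  then have "a \<in> arcs G" "tail G a = u"
    by auto
  then show ?thesis
    using a that arc_edge by metis
qed

text \<open>
  The largest distance of a point of \<open>F u\<close> from \<open>[0, 1]\<close> is a function of \<open>u\<close> to which the
  contraction principle applies, because every similarity maps \<open>[0, 1]\<close> into itself.
\<close>

lemma F_subset_unit:
  assumes "u \<in> verts G"
  shows "F u \<subseteq> {0..1}"
proof -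
  obtain \<rho> where \<rho>: "0 < \<rho>" "\<rho> < 1" "\<And>a. a \<in> arcs G \<Longrightarrow> \<bar>r a\<bar> \<le> \<rho>"
    using uniform_ratio by blast
  \<comment> \<open>a point of \<open>F v\<close> at the largest distance from the unit interval\<close>
  define far where "far v = (SOME t. t \<in> F v \<and> (\<forall>s\<in>F v. infdist s {0..1} \<le> infdist t {0..1}))" for v
  have far: "far v \<in> F v \<and> (\<forall>s\<in>F v. infdist s {0..1} \<le> infdist (far v) {0..1})" if "v \<in> verts G" for v
    unfolding far_def
  proof (rule someI_ex)
    show "\<exists>t. t \<in> F v \<and> (\<forall>s\<in>F v. infdist s {0..1} \<le> infdist t {0..1})"
      using continuous_attains_sup[OF F_compact[OF that] F_nonempty[OF that] continuous_on_infdist[OF continuous_on_id]]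
      by blast
  qed
  have "infdist (far u) {0..1} = 0"
  proof (rule finite_contraction_zero[of "verts G" \<rho>])
    fix v assume v: "v \<in> verts G"
    obtain k t where k: "k \<in> {1..deg v}" "t \<in> F (head G (\<epsilon> v k))" "far v = sim (\<epsilon> v k) t"
      using F_cases[OF v] far[OF v] by blast
    let ?a = "\<epsilon> v k"
    have a: "?a \<in> arcs G" "head G ?a \<in> verts G"
      using edge_arc[OF v k(1)] by auto
    obtain s where s: "s \<in> {0..1}" "infdist t {0..1} = dist t s"
      using infdist_attains_inf[of "{0..1::real}" t] by auto
    have "infdist (far v) {0..1} \<le> dist (sim ?a t) (sim ?a s)"
      unfolding k(3) by (rule infdist_le[OF sim_unit[OF a(1) s(1)]])
    also have "\<dots> = \<bar>r ?a\<bar> * dist t s"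
      by (simp add: sim_def dist_real_def algebra_simps flip: abs_mult)
    also have "\<dots> \<le> \<rho> * infdist (far (head G ?a)) {0..1}"
      using far[OF a(2)] k(2) \<rho>(1) \<rho>(3)[OF a(1)] unfolding s(2)[symmetric]
      by (intro mult_mono) (auto simp: infdist_nonneg)
    finally show "\<exists>w\<in>verts G. infdist (far v) {0..1} \<le> \<rho> * infdist (far w) {0..1}"
      using a(2) by blast
  qed (use \<rho> assms in \<open>auto simp: infdist_nonneg\<close>)
  then have zero: "infdist s {0..1} = 0" if "s \<in> F u" for s
    using far[OF assms] that infdist_nonneg[of s "{0..1}"] by fastforce
  then show ?thesis
    using in_closed_iff_infdist_zero[of "{0..1::real}"] by fastforce
qed

text \<open>
  The first interval starts at 0 and the last one ends at 1, so each endpoint of \<open>[0, 1]\<close> is the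
  image of an endpoint under an edge leaving \<open>u\<close>. The contraction principle therefore applies to
  the distances of both endpoints from all attractors.
\<close>

lemma endpoint_in_F:
  assumes "u \<in> verts G" "s \<in> {0, 1}"
  shows "s \<in> F u"
proof -
  obtain \<rho> where \<rho>: "0 < \<rho>" "\<rho> < 1" "\<And>a. a \<in> arcs G \<Longrightarrow> \<bar>r a\<bar> \<le> \<rho>"
    using uniform_ratio by blast
  define h where "h = (\<lambda>(v, s). infdist s (F v))"
  have "h (u, s) = 0"
  proof (rule finite_contraction_zero[of "verts G \<times> {0, 1}" \<rho>])
    fix z assume "z \<in> verts G \<times> {0, 1::real}"
    then obtain v e where z: "z = (v, e)" "v \<in> verts G" "e \<in> {0, 1}"
      by auto
    define k where "k = (if e = 0 then 1 else deg v)"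
    let ?a = "\<epsilon> v k"
    have k: "k \<in> {1..deg v}"
      using degree[OF z(2)] by (auto simp: k_def)
    have a: "?a \<in> arcs G" "tail G ?a = v" "head G ?a \<in> verts G"
      using edge_arc[OF z(2) k] by auto
    have "e \<in> {sim ?a 0, sim ?a 1}"
      using ends[OF z(2) k] lo_first[OF z(2)] hi_last[OF z(2)] z(3)
      by (auto simp: k_def sim_def split: if_splits)
    then obtain e' where e': "e' \<in> {0, 1}" "e = sim ?a e'"
      by auto
    obtain t where t: "t \<in> F (head G ?a)" "infdist e' (F (head G ?a)) = dist e' t"
      using infdist_attains_inf[of "F (head G ?a)" e'] F_compact[OF a(3)] F_nonempty[OF a(3)]
        compact_imp_closed by auto
    have "h z \<le> dist (sim ?a e') (sim ?a t)"
      unfolding h_def z prod.case e'(2)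
      using sim_F[OF a(1) t(1)] a(2) by (intro infdist_le) simp
    also have "\<dots> = \<bar>r ?a\<bar> * dist e' t"
      by (simp add: sim_def dist_real_def algebra_simps flip: abs_mult)
    also have "\<dots> \<le> \<rho> * h (head G ?a, e')"
      using \<rho>(3)[OF a(1)] by (auto simp: h_def t(2) intro: mult_right_mono)
    finally show "\<exists>w\<in>verts G \<times> {0, 1}. h z \<le> \<rho> * h w"
      using a(3) e'(1) by blast
  qed (use \<rho> assms in \<open>auto simp: h_def infdist_nonneg\<close>)
  then show ?thesis
    using in_closed_iff_infdist_zero[of "F u" s] F_compact[OF assms(1)] F_nonempty[OF assms(1)]
      compact_imp_closed by (auto simp: h_def)
qed

lemma lo_hi_in_F:
  assumes "u \<in> verts G" "k \<in> {1..deg u}"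
  shows "lo u k \<in> F u" "hi u k \<in> F u"
proof -
  note a = edge_arc[OF assms]
  have "sim (\<epsilon> u k) 0 \<in> F u" "sim (\<epsilon> u k) 1 \<in> F u"
    using sim_F[OF a(2)] endpoint_in_F[OF a(4)] a(3) by auto
  then show "lo u k \<in> F u" "hi u k \<in> F u"
    using ends[OF assms] by (auto simp: sim_def)
qed

lemma F_in_interval:
  assumes "u \<in> verts G" "y \<in> F u"
  obtains k where "k \<in> {1..deg u}" "y \<in> {lo u k..hi u k}"
proof -
  obtain k t where k: "k \<in> {1..deg u}" "t \<in> F (head G (\<epsilon> u k))" "y = sim (\<epsilon> u k) t"
    using F_cases[OF assms] by blast
  have "t \<in> {0..1}"
    using F_subset_unit[OF edge_arc(4)[OF assms(1) k(1)]] k(2) by blast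
  then show ?thesis
    using that[OF k(1)] sim_in_interval[OF assms(1) k(1)] k(3) by blast
qed

text \<open>
  The strong separation of the intervals makes the part of \<open>F u\<close> in the interval of one edge come
  from that edge alone.
\<close>

lemma F_inter_interval:
  assumes "u \<in> verts G" "k \<in> {1..deg u}" "sim (\<epsilon> u k) t \<in> F u" "t \<in> {0..1}"
  shows "t \<in> F (head G (\<epsilon> u k))"
proof -
  obtain m s where m: "m \<in> {1..deg u}" "s \<in> F (head G (\<epsilon> u m))" "sim (\<epsilon> u k) t = sim (\<epsilon> u m) s"
    using F_cases[OF assms(1,3)] by blast
  note k_arc = edge_arc[OF assms(1,2)] and m_arc = edge_arc[OF assms(1) m(1)]
  have "s \<in> {0..1}"
    using F_subset_unit[OF m_arc(4)] m(2) by blast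
  then have eq: "\<epsilon> u k = \<epsilon> u m"
    using sim_eq_imp_arc_eq k_arc m_arc assms(4) m(3) by metis
  then show ?thesis
    using m(2,3) sim_inj k_arc(2) by metis
qed

lemma gap_misses_F:
  assumes "u \<in> verts G" "1 \<le> k" "k < deg u" "y \<in> F u"
  shows "y \<le> hi u k \<or> hi u k + \<delta> \<le> y"
proof -
  obtain m where m: "m \<in> {1..deg u}" "y \<in> {lo u m..hi u m}"
    using F_in_interval[OF assms(1,4)] by blast
  consider "m = k" | "m < k" | "k < m"
    by linarith
  then show ?thesis
  proof cases
    case 2
    then show ?thesis
      using hi_lo_separated[of u m k] lo_less_hi[of u k] m assms gap_pos by auto
  next
    case 3
    then show ?thesis
      using hi_lo_separated[of u k m] m assms by auto
  qed (use m in auto)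
qed

section \<open>The longest gaps have length \<open>\<delta>\<close>\<close>

text \<open>
  The ends of first-level intervals belong to \<open>F u\<close>, and \<open>(s, t)\<close> is too long for a gap between two
  of them; avoiding these ends, it has to sit inside one of the intervals.
\<close>

lemma long_interval_cases:
  assumes u: "u \<in> verts G" and "0 \<le> s" "t \<le> 1" "\<delta> < t - s"
  shows "(\<exists>y\<in>F u. s < y \<and> y < t) \<or> (\<exists>k\<in>{1..deg u}. lo u k \<le> s \<and> t \<le> hi u k)"
proof -
  \<comment> \<open>\<open>k\<close> is the index of the last interval that starts no later than \<open>s\<close>\<close>
  define K where "K = {k \<in> {1..deg u}. lo u k \<le> s}"
  define k where "k = Max K"
  have K: "finite K" "1 \<in> K"
    using lo_first[OF u] degree[OF u] \<open>0 \<le> s\<close> by (auto simp: K_def)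
  then have "k \<in> K"
    unfolding k_def using Max_in by blast
  then have k: "k \<in> {1..deg u}" "lo u k \<le> s"
    by (auto simp: K_def)
  show ?thesis
  proof (cases "hi u k \<le> s")
    case True
    have "k \<noteq> deg u"
      using True assms(3,4) hi_last[OF u] gap_pos by auto
    then have k': "1 \<le> k" "k < deg u"
      using k by auto
    then have "Suc k \<notin> K"
      using Max_ge[OF K(1), of "Suc k"] unfolding k_def[symmetric] by auto
    then have "s < lo u (Suc k)"
      using k' by (auto simp: K_def)
    moreover have "lo u (Suc k) < t"
      using lo_Suc[OF u k'] True assms(4) by linarith
    ultimately show ?thesis
      using lo_hi_in_F(1)[OF u, of "Suc k"] k' by auto
  next
    case False
    then show ?thesis
      using k lo_hi_in_F(2)[OF u k(1)] by (meson not_le)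
  qed
qed

text \<open>
  An interval of length more than \<open>\<delta>\<close> missing \<open>F u\<close> would lie in a first-level interval, so undoing
  the similarity of that edge gives an interval missing another attractor that is longer by a factor
  of at least \<open>1 / \<rho>\<close>. Repeating this \<open>n\<close> times within \<open>[0, 1]\<close> bounds the original length by \<open>\<rho>\<^sup>n\<close>.
\<close>

lemma F_meets_long_interval:
  assumes "u \<in> verts G" "0 \<le> s" "t \<le> 1" "\<delta> < t - s"
  shows "\<exists>y\<in>F u. s < y \<and> y < t"
proof -
  obtain \<rho> where \<rho>: "0 < \<rho>" "\<rho> < 1" "\<And>a. a \<in> arcs G \<Longrightarrow> \<bar>r a\<bar> \<le> \<rho>"
    using uniform_ratio by blast
  have bound: "t - s \<le> \<rho> ^ n"
    if "u \<in> verts G" "0 \<le> s" "t \<le> 1" "\<delta> < t - s" "\<not> (\<exists>y\<in>F u. s < y \<and> y < t)" for n u s t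
    using that
  proof (induction n arbitrary: u s t)
    case (Suc n)
    obtain k where k: "k \<in> {1..deg u}" "lo u k \<le> s" "t \<le> hi u k"
      using long_interval_cases Suc.prems by blast
    let ?a = "\<epsilon> u k"
    have u: "u \<in> verts G"
      by fact
    note a = edge_arc[OF u k(1)]
    have "s < t"
      using Suc.prems(4) gap_pos by linarith
    obtain s' where s': "s' \<in> {0..1}" "s = sim ?a s'"
      using interval_eq_sim[OF u k(1), of s] k \<open>s < t\<close> by auto
    obtain t' where t': "t' \<in> {0..1}" "t = sim ?a t'"
      using interval_eq_sim[OF u k(1), of t] k \<open>s < t\<close> by auto
    \<comment> \<open>ordered preimages, since the similarity may reverse orientation\<close>
    define p q where "p = min s' t'" and "q = max s' t'"
    have pq: "0 \<le> p" "q \<le> 1" "p \<le> q"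
      using s' t' by (auto simp: p_def q_def)
    have len: "t - s = \<bar>r ?a\<bar> * (q - p)"
    proof -
      have "t - s = r ?a * (t' - s')"
        by (simp add: s' t' sim_def algebra_simps)
      then have "\<bar>t - s\<bar> = \<bar>r ?a\<bar> * \<bar>t' - s'\<bar>"
        by (simp add: abs_mult)
      then show ?thesis
        using \<open>s < t\<close> by (auto simp: p_def q_def min_def max_def)
    qed
    have between: "s < sim ?a y \<and> sim ?a y < t" if "p < y" "y < q" for y
    proof (cases "0 < r ?a")
      case True
      then have "s' < t'"
        using \<open>s < t\<close> unfolding s' t' sim_def by simp
      then show ?thesis
        using that True by (auto simp: p_def q_def s' t' sim_def)
    next
      case False
      then have neg: "r ?a < 0"
        using ratio[OF a(2)] by auto
      then have "t' < s'"
        using \<open>s < t\<close> unfolding s' t' sim_def by (simp add: mult_less_cancel_left)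
      then show ?thesis
        using that neg by (auto simp: p_def q_def s' t' sim_def mult_less_cancel_left)
    qed
    have "t - s \<le> q - p"
      unfolding len using pq ratio[OF a(2)] by (intro mult_left_le_one_le) auto
    then have "\<delta> < q - p"
      using Suc.prems(4) by linarith
    moreover have "\<not> (\<exists>y\<in>F (head G ?a). p < y \<and> y < q)"
      using between sim_F[OF a(2)] a(3) Suc.prems(5) by auto
    ultimately have "q - p \<le> \<rho> ^ n"
      using Suc.IH a(4) pq by blast
    then have "\<bar>r ?a\<bar> * (q - p) \<le> \<rho> * \<rho> ^ n"
      using \<rho>(1) \<rho>(3)[OF a(2)] pq by (intro mult_mono) auto
    then show ?case
      using len by simp
  qed simp
  show ?thesis
  proof (rule ccontr)
    assume no: "\<not> ?thesis"
    obtain n where "\<rho> ^ n < \<delta>"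
      using real_arch_pow_inv[OF gap_pos \<rho>(2)] by blast
    then show False
      using bound[OF assms no, of n] assms(4) by linarith
  qed
qed

section \<open>Affine copies of an attractor inside an attractor\<close>

text \<open>
  Otherwise the copy would reach across a gap of length \<open>\<delta>\<close> of \<open>F u\<close>. The preimage of this gap
  would be an interval of length \<open>\<delta> / \<bar>\<alpha>\<bar> > \<delta>\<close> missing \<open>F i\<close>.
\<close>

lemma affine_copy_in_interval:
  assumes i: "i \<in> verts G" and u: "u \<in> verts G"
    and \<alpha>: "\<alpha> \<noteq> 0" "\<bar>\<alpha>\<bar> < 1"
    and copy: "\<And>t. t \<in> F i \<Longrightarrow> \<alpha> * t + \<beta> \<in> F u"
  obtains k where "k \<in> {1..deg u}" "\<And>t. t \<in> {0..1} \<Longrightarrow> \<alpha> * t + \<beta> \<in> {lo u k..hi u k}"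
proof -
  \<comment> \<open>the endpoints of the convex hull of the copy, which belong to the copy\<close>
  define p q where "p = min \<beta> (\<alpha> + \<beta>)" and "q = max \<beta> (\<alpha> + \<beta>)"
  have "p \<in> F u" "q \<in> F u"
    using copy[of 0] copy[of 1] endpoint_in_F[OF i] by (auto simp: p_def q_def min_def max_def)
  then obtain k m where k: "k \<in> {1..deg u}" "p \<in> {lo u k..hi u k}"
    and m: "m \<in> {1..deg u}" "q \<in> {lo u m..hi u m}"
    using F_in_interval[OF u] by metis
  have "p \<le> q"
    by (simp add: p_def q_def)
  have "\<not> m < k"
    using hi_lo_separated[OF u, of m k] k m gap_pos \<open>p \<le> q\<close> by auto
  moreover have "\<not> k < m"
  proof
    assume "k < m"
    then have gap: "p \<le> hi u k" "hi u k + \<delta> \<le> q"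
      using hi_lo_separated[OF u, of k m] k m by auto
    define x y where "x = (hi u k - \<beta>) / \<alpha>" and "y = (hi u k + \<delta> - \<beta>) / \<alpha>"
    define s t where "s = min x y" and "t = max x y"
    have xy: "\<alpha> * x + \<beta> = hi u k" "\<alpha> * y + \<beta> = hi u k + \<delta>"
      using \<alpha>(1) by (simp_all add: x_def y_def)
    have unit: "(z - \<beta>) / \<alpha> \<in> {0..1}" if "p \<le> z" "z \<le> q" for z
    proof (cases "0 < \<alpha>")
      case True
      then have "0 \<le> z - \<beta>" "z - \<beta> \<le> \<alpha>"
        using that by (auto simp: p_def q_def)
      then show ?thesis
        using True by simp
    next
      case False
      then have "\<alpha> < 0" "z - \<beta> \<le> 0" "\<alpha> \<le> z - \<beta>"
        using \<alpha>(1) that by (auto simp: p_def q_def)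
      then show ?thesis
        by (simp add: divide_nonpos_neg)
    qed
    have xy_unit: "x \<in> {0..1}" "y \<in> {0..1}"
      unfolding x_def y_def using gap gap_pos by (auto simp del: atLeastAtMost_iff intro!: unit)
    have "\<alpha> * (y - x) = \<delta>"
      using xy by (simp add: algebra_simps)
    then have "\<bar>\<alpha>\<bar> * (t - s) = \<delta>"
      using gap_pos abs_mult[of \<alpha> "y - x"] by (auto simp: s_def t_def min_def max_def)
    moreover have "s \<noteq> t"
      using xy gap_pos by (auto simp: s_def t_def min_def max_def split: if_splits)
    then have "0 < t - s"
      by (auto simp: s_def t_def)
    ultimately have "\<delta> < t - s"
      using \<alpha>(2) mult_strict_right_mono[of "\<bar>\<alpha>\<bar>" 1 "t - s"] by simp
    then obtain z where z: "z \<in> F i" "s < z" "z < t"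
      using F_meets_long_interval[OF i, of s t] xy_unit by (auto simp: s_def t_def)
    have "hi u k < \<alpha> * z + \<beta> \<and> \<alpha> * z + \<beta> < hi u k + \<delta>"
    proof (cases "0 < \<alpha>")
      case True
      then have "x < y"
        using \<open>\<alpha> * (y - x) = \<delta>\<close> gap_pos by (metis diff_gt_0_iff_gt zero_less_mult_pos)
      then have "\<alpha> * x < \<alpha> * z" "\<alpha> * z < \<alpha> * y"
        using z True by (auto simp: s_def t_def)
      then show ?thesis
        using xy by linarith
    next
      case False
      then have neg: "\<alpha> < 0"
        using \<alpha>(1) by simp
      then have "y < x"
        using \<open>\<alpha> * (y - x) = \<delta>\<close> gap_pos by (smt (verit) mult_nonpos_nonneg)
      then have "\<alpha> * x < \<alpha> * z" "\<alpha> * z < \<alpha> * y"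
        using z neg by (auto simp: s_def t_def)
      then show ?thesis
        using xy by linarith
    qed
    then show False
      using gap_misses_F[OF u _ _ copy[OF z(1)], of k] k m \<open>k < m\<close> by auto
  qed
  ultimately have "k = m"
    by linarith
  have "\<alpha> * t + \<beta> \<in> {lo u k..hi u k}" if "t \<in> {0..1}" for t
  proof -
    have "(1 - t) *\<^sub>R \<beta> + t *\<^sub>R (\<alpha> + \<beta>) \<in> {lo u k..hi u k}"
      using k m \<open>k = m\<close> that
      by (intro convexD[OF convex_real_interval(5)]) (auto simp: p_def q_def min_def max_def split: if_splits)
    then show ?thesis
      by (simp add: algebra_simps)
  qed
  then show ?thesis
    using that k(1) by blast
qed

text \<open>
  Undoing one edge at a time enlarges the copy by a factor of at least \<open>1 / \<rho>\<close>; hence \<open>n\<close> steps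
  are enough for a ratio of modulus at least \<open>\<rho>\<^sup>n\<close>.
\<close>

lemma affine_copy_descent:
  assumes i: "i \<in> verts G"
    and \<rho>: "0 < \<rho>" "\<And>a. a \<in> arcs G \<Longrightarrow> \<bar>r a\<bar> \<le> \<rho>"
    and "u \<in> verts G" "\<alpha> \<noteq> 0" "\<rho> ^ n \<le> \<bar>\<alpha>\<bar>"
    and "\<And>t. t \<in> F i \<Longrightarrow> \<alpha> * t + \<beta> \<in> F u"
  shows "\<exists>p v \<alpha>' \<beta>'. awalk u p v \<and> 1 \<le> \<bar>\<alpha>'\<bar> \<and> (\<forall>t\<in>F i. \<alpha>' * t + \<beta>' \<in> F v) \<and>
           (\<forall>t. \<alpha> * t + \<beta> = word_sim p (\<alpha>' * t + \<beta>'))"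
  using assms(4-)
proof (induction n arbitrary: u \<alpha> \<beta>)
  case 0
  then show ?case
    by (intro exI[of _ "[]"] exI[of _ u] exI[of _ \<alpha>] exI[of _ \<beta>]) (simp add: awalk_Nil_iff)
next
  case (Suc n)
  show ?case
  proof (cases "1 \<le> \<bar>\<alpha>\<bar>")
    case True
    then show ?thesis
      using Suc.prems
      by (intro exI[of _ "[]"] exI[of _ u] exI[of _ \<alpha>] exI[of _ \<beta>]) (simp add: awalk_Nil_iff)
  next
    case False
    have u: "u \<in> verts G"
      by fact
    obtain k where k: "k \<in> {1..deg u}" "\<And>t. t \<in> {0..1} \<Longrightarrow> \<alpha> * t + \<beta> \<in> {lo u k..hi u k}"
      using affine_copy_in_interval[of i u \<alpha> \<beta>] i Suc.prems False by (metis not_le)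
    let ?a = "\<epsilon> u k"
    note a = edge_arc[OF u k(1)]
    define \<alpha>' \<beta>' where "\<alpha>' = \<alpha> / r ?a" and "\<beta>' = (\<beta> - c ?a) / r ?a"
    have r: "r ?a \<noteq> 0"
      using ratio[OF a(2)] by auto
    have factor: "\<alpha> * t + \<beta> = sim ?a (\<alpha>' * t + \<beta>')" for t
      using r by (simp add: sim_def \<alpha>'_def \<beta>'_def field_simps)
    have "\<alpha>' \<noteq> 0"
      using Suc.prems(2) r by (simp add: \<alpha>'_def)
    moreover have "\<rho> ^ n \<le> \<bar>\<alpha>'\<bar>"
    proof -
      have "\<bar>r ?a\<bar> * \<rho> ^ n \<le> \<rho> * \<rho> ^ n"
        using \<rho>(1) \<rho>(2)[OF a(2)] by (intro mult_right_mono) auto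
      then have "\<bar>r ?a\<bar> * \<rho> ^ n \<le> \<bar>\<alpha>\<bar>"
        using Suc.prems(3) by simp
      then show ?thesis
        using r by (simp add: \<alpha>'_def abs_divide field_simps)
    qed
    moreover have "\<alpha>' * t + \<beta>' \<in> F (head G ?a)" if "t \<in> F i" for t
    proof -
      have "t \<in> {0..1}"
        using F_subset_unit[OF i] that by blast
      then obtain s where s: "s \<in> {0..1}" "\<alpha> * t + \<beta> = sim ?a s"
        using interval_eq_sim[OF u k(1) k(2)] by blast
      then have "\<alpha>' * t + \<beta>' = s"
        using factor sim_inj[OF a(2)] by metis
      then show ?thesis
        using F_inter_interval[OF u k(1) _ s(1)] s(2) Suc.prems(4)[OF that] by simp
    qed
    ultimately obtain p v \<alpha>'' \<beta>'' where p: "awalk (head G ?a) p v" "1 \<le> \<bar>\<alpha>''\<bar>"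
      "\<forall>t\<in>F i. \<alpha>'' * t + \<beta>'' \<in> F v" "\<forall>t. \<alpha>' * t + \<beta>' = word_sim p (\<alpha>'' * t + \<beta>'')"
      using Suc.IH[OF a(4)] by blast
    have "awalk u (?a # p) v"
      using p(1) a by (simp add: awalk_Cons_iff)
    moreover have "\<forall>t. \<alpha> * t + \<beta> = word_sim (?a # p) (\<alpha>'' * t + \<beta>'')"
      using factor p(4) by simp
    ultimately show ?thesis
      using p(2,3) by blast
  qed
qed

text \<open>
  At the end of the descent the ratio has modulus at least 1 while the copy stays in \<open>[0, 1]\<close>, which
  leaves only the identity and the reflection. The copy then contains \<open>hi i 1\<close> or its mirror image,
  and \<open>avoid\<close> says that no attractor other than \<open>F i\<close> contains these points.
\<close>

lemma self_copy_closed_walk: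
  assumes i: "i \<in> verts G"
    and avoid: "\<And>j. j \<in> verts G \<Longrightarrow> j \<noteq> i \<Longrightarrow> hi i 1 \<notin> F j \<and> 1 - hi i 1 \<notin> F j"
    and f: "contracting_similarity f" "f ` F i \<subseteq> F i"
  obtains p where "awalk i p i" "p \<noteq> []" "f ` F i \<subseteq> word_sim p ` {0..1}"
proof -
  obtain \<alpha> \<beta> where \<alpha>: "\<alpha> \<noteq> 0" "\<bar>\<alpha>\<bar> < 1" and f_eq: "f = (\<lambda>t. \<alpha> * t + \<beta>)"
    using f(1) unfolding contracting_similarity_def by auto
  obtain \<rho> where \<rho>: "0 < \<rho>" "\<rho> < 1" "\<And>a. a \<in> arcs G \<Longrightarrow> \<bar>r a\<bar> \<le> \<rho>"
    using uniform_ratio by blast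
  obtain n where n: "\<rho> ^ n < \<bar>\<alpha>\<bar>"
    using real_arch_pow_inv[OF _ \<rho>(2), of "\<bar>\<alpha>\<bar>"] \<alpha>(1) by auto
  have "\<exists>p v \<alpha>' \<beta>'. awalk i p v \<and> 1 \<le> \<bar>\<alpha>'\<bar> \<and> (\<forall>t\<in>F i. \<alpha>' * t + \<beta>' \<in> F v) \<and>
           (\<forall>t. \<alpha> * t + \<beta> = word_sim p (\<alpha>' * t + \<beta>'))"
    using f(2) n \<alpha>(1) by (intro affine_copy_descent[OF i \<rho>(1,3) i, of \<alpha> n \<beta>]) (auto simp: f_eq)
  then obtain p v \<alpha>' \<beta>' where p: "awalk i p v" "1 \<le> \<bar>\<alpha>'\<bar>"
    and copy: "\<And>t. t \<in> F i \<Longrightarrow> \<alpha>' * t + \<beta>' \<in> F v"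
    and factor: "\<And>t. \<alpha> * t + \<beta> = word_sim p (\<alpha>' * t + \<beta>')"
    by blast
  have v: "v \<in> verts G"
    using p(1) by auto
  have "p \<noteq> []"
  proof
    assume "p = []"
    then have "\<alpha> = \<alpha>'"
      using factor[of 0] factor[of 1] by simp
    then show False
      using p(2) \<alpha>(2) by simp
  qed
  have "\<beta>' \<in> {0..1}" "\<alpha>' + \<beta>' \<in> {0..1}"
    using copy[of 0] copy[of 1] endpoint_in_F[OF i] F_subset_unit[OF v] by auto
  then have isometry: "\<alpha>' = 1 \<and> \<beta>' = 0 \<or> \<alpha>' = - 1 \<and> \<beta>' = 1"
    using p(2) by auto
  have "hi i 1 \<in> F i"
    using lo_hi_in_F(2)[OF i, of 1] degree[OF i] by simp
  from copy[OF this] have "hi i 1 \<in> F v \<or> 1 - hi i 1 \<in> F v"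
    using isometry by auto
  then have "v = i"
    using avoid[OF v] by blast
  moreover have "f ` F i \<subseteq> word_sim p ` {0..1}"
    using copy F_subset_unit[OF v] factor by (auto simp: f_eq)
  ultimately show ?thesis
    using that p(1) \<open>p \<noteq> []\<close> by blast
qed

section \<open>Coding by walks\<close>

lemma word_sim_unit: "set p \<subseteq> arcs G \<Longrightarrow> t \<in> {0..1} \<Longrightarrow> word_sim p t \<in> {0..1}"
  by (induction p) (use sim_unit in auto)

lemma word_sim_F: "awalk u p v \<Longrightarrow> t \<in> F v \<Longrightarrow> word_sim p t \<in> F u"
  by (induction p arbitrary: u) (use sim_F in \<open>auto simp: awalk_Cons_iff awalk_Nil_iff\<close>)

text \<open>
  Walks are determined by the points of their cylinders: the first edge can be read off from the
  disjoint first-level intervals and then be cancelled.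
\<close>

lemma word_sim_eq_imp_prefix:
  assumes "awalk u p v" "awalk u q w" "length p \<le> length q"
    and "s \<in> {0..1}" "t \<in> {0..1}" "word_sim p s = word_sim q t"
  shows "\<exists>q'. q = p @ q'"
  using assms
proof (induction p arbitrary: u q)
  case (Cons a p)
  then obtain b q0 where q: "q = b # q0"
    by (cases q) auto
  have arcs: "a \<in> arcs G" "b \<in> arcs G" "tail G a = tail G b" "set p \<subseteq> arcs G" "set q0 \<subseteq> arcs G"
    and walks: "awalk (head G a) p v" "awalk (head G b) q0 w"
    using Cons.prems(1,2) by (auto simp: q awalk_Cons_iff)
  have eq: "sim a (word_sim p s) = sim b (word_sim q0 t)"
    using Cons.prems(6) by (simp add: q)
  have "a = b"
    using sim_eq_imp_arc_eq[OF arcs(1-3) _ _ eq] word_sim_unit arcs Cons.prems(4,5) by blast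
  then have "\<exists>q'. q0 = p @ q'"
    using Cons.IH[OF walks(1), of q0] walks(2) Cons.prems(3-5) eq sim_inj[OF arcs(1)] by (auto simp: q)
  then show ?case
    using \<open>a = b\<close> q by simp
qed simp

text \<open>
  The vertices of a circuit are exactly the tails of its edges, and each edge leads back into this
  set, so that walks inside it can be prolonged forever.
\<close>

lemma walk_along_circuit:
  assumes "awalk u p u" "p \<noteq> []" "v \<in> tail G ` set p"
  shows "\<exists>q w. awalk v q w \<and> length q = n \<and> head G ` set q \<subseteq> tail G ` set p"
proof -
  have closed: "head G ` set p \<subseteq> tail G ` set p"
  proof -
    have "head G ` set q \<subseteq> tail G ` set q \<union> {w}" if "cas v q w" for v q w
      using that
    proof (induction q arbitrary: v)
      case (Cons a q)
      then have "head G a \<in> tail G ` set q \<union> {w}"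
        by (cases q) auto
      then show ?case
        using Cons by auto
    qed simp
    moreover have "u \<in> tail G ` set p"
      using assms(1,2) by (cases p) (auto simp: awalk_Cons_iff)
    ultimately show ?thesis
      using assms(1) unfolding awalk_def by blast
  qed
  show ?thesis
    using assms(3)
  proof (induction n arbitrary: v)
    case 0
    then have "v \<in> verts G"
      using assms(1) by (auto simp: awalk_def)
    then show ?case
      by (intro exI[of _ "[]"]) (auto simp: awalk_Nil_iff)
  next
    case (Suc n)
    then obtain a where a: "a \<in> set p" "v = tail G a"
      by auto
    then have "head G a \<in> tail G ` set p" "a \<in> arcs G"
      using closed assms(1) by auto
    moreover from this obtain q w where "awalk (head G a) q w" "length q = n" "head G ` set q \<subseteq> tail G ` set p"
      using Suc.IH by blast
    ultimately show ?case
      using a(2) by (intro exI[of _ "a # q"] exI[of _ w]) (auto simp: awalk_Cons_iff)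
  qed
qed

text \<open>
  The walk follows a shortest walk \<open>q1\<close> from \<open>i\<close> to the circuit and then the circuit. A return to \<open>i\<close>
  on \<open>q1\<close> would allow a shortcut, and \<open>i\<close> is not on the circuit.
\<close>

lemma long_walk_without_return:
  assumes "i \<in> verts G" and "strongly_conn G" and "circuit_avoiding G i"
  obtains q w where "awalk i q w" "n \<le> length q"
    "\<And>z z'. q = z @ z' \<Longrightarrow> awalk i z i \<Longrightarrow> z = []"
proof -
  obtain u p where p: "awalk u p u" "p \<noteq> []" "i \<notin> set (awalk_verts u p)"
    using assms(3) unfolding circuit_avoiding_def directed_path_def by auto
  have u: "u \<in> tail G ` set p" "u \<in> verts G"
    using p(1,2) by (cases p; auto simp: awalk_Cons_iff)+
  have i: "i \<notin> tail G ` set p"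
    using p set_awalk_verts[of u p u] by (auto simp: awalk_def)
  have "\<exists>p. awalk i p u"
    using assms(1,2) u(2) unfolding strongly_conn_def directed_path_def by blast
  then obtain q1 where q1: "awalk i q1 u" and min: "\<And>q'. awalk i q' u \<Longrightarrow> length q1 \<le> length q'"
    using arg_min_nat_lemma[of "\<lambda>p. awalk i p u" _ length] by metis
  obtain q2 w where q2: "awalk u q2 w" "length q2 = n" "head G ` set q2 \<subseteq> tail G ` set p"
    using walk_along_circuit[OF p(1,2) u(1)] by blast
  have "z = []" if z: "q1 @ q2 = z @ z'" "awalk i z i" for z z'
  proof -
    from z(1) consider y where "q1 = z @ y" | y where "z = q1 @ y" "q2 = y @ z'"
      by (auto simp: append_eq_append_conv2)
    then show ?thesis
    proof cases
      case 1
      then have "awalk i y u"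
        using q1 z(2) by (auto simp: awalk_append_iff dest: awalk_ends)
      then show ?thesis
        using min 1 by fastforce
    next
      case 2
      then have y: "awalk u y i"
        using q1 z(2) by (auto simp: awalk_append_iff dest: awalk_ends)
      have "y \<noteq> []"
        using y u(1) i by (auto simp: awalk_Nil_iff)
      then have "head G (last y) = i" "last y \<in> set q2"
        using y 2 by (auto simp: awalk_verts_conv)
      then show ?thesis
        using q2(3) i by blast
    qed
  qed
  moreover have "awalk i (q1 @ q2) w"
    using q1 q2(1) by (rule awalk_appendI)
  ultimately show ?thesis
    using that[of "q1 @ q2" w] q2(2) by simp
qed

text \<open>
  Were there a standard IFS with attractor \<open>F i\<close>, a point with a long address that never returns to
  \<open>i\<close> would have to lie in the cylinder of one of finitely many closed walks at \<open>i\<close>, and this walk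
  would be an initial segment of the address.
\<close>

theorem not_standard_attractor:
  assumes i: "i \<in> verts G" and "strongly_conn G" and "circuit_avoiding G i"
    and avoid: "\<And>j. j \<in> verts G \<Longrightarrow> j \<noteq> i \<Longrightarrow> hi i 1 \<notin> F j \<and> 1 - hi i 1 \<notin> F j"
    and \<Phi>: "standard_ifs \<Phi>"
  shows "\<not> ifs_attractor \<Phi> (F i)"
proof
  assume "ifs_attractor \<Phi> (F i)"
  then have cover: "F i = (\<Union>f\<in>\<Phi>. f ` F i)"
    by (simp add: ifs_attractor_def)
  have "\<exists>p. awalk i p i \<and> p \<noteq> [] \<and> f ` F i \<subseteq> word_sim p ` {0..1}" if "f \<in> \<Phi>" for f
    using self_copy_closed_walk[OF i avoid, of f] \<Phi> cover that
    unfolding standard_ifs_def by (metis UN_upper)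
  then obtain w where w: "\<And>f. f \<in> \<Phi> \<Longrightarrow> awalk i (w f) i \<and> w f \<noteq> [] \<and> f ` F i \<subseteq> word_sim (w f) ` {0..1}"
    by metis
  have fin: "finite ((\<lambda>f. length (w f)) ` \<Phi>)"
    using \<Phi> by (simp add: standard_ifs_def)
  obtain q v where q: "awalk i q v" "Max ((\<lambda>f. length (w f)) ` \<Phi>) \<le> length q"
    "\<And>z z'. q = z @ z' \<Longrightarrow> awalk i z i \<Longrightarrow> z = []"
    using long_walk_without_return[OF assms(1-3)] by blast
  have v: "v \<in> verts G"
    using q(1) by auto
  have "word_sim q 0 \<in> F i"
    using word_sim_F[OF q(1)] endpoint_in_F[OF v] by simp
  then obtain f where f: "f \<in> \<Phi>" "word_sim q 0 \<in> f ` F i"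
    using cover by blast
  then obtain s where s: "s \<in> {0..1}" "word_sim (w f) s = word_sim q 0"
    using w[OF f(1)] by (metis image_iff subsetD)
  have "length (w f) \<le> length q"
    using q(2) fin f(1) by (meson Max_ge imageI le_trans)
  then obtain q' where "q = w f @ q'"
    using word_sim_eq_imp_prefix[OF _ q(1) _ s(1) _ s(2)] w[OF f(1)] by auto
  then show False
    using q(3) w[OF f(1)] by blast
qed

end

section \<open>The parametrised family\<close>

text \<open>
  The right end of the \<open>k\<close>-th interval is the lower bound that appears in the gap hypotheses of the
  theorem, and for \<open>k\<close> equal to the out-degree it is 1 by the defining equation of the parameters.
\<close>

lemma offset_eq_sum:
  assumes "1 \<le> k"
  shows "offset G \<delta> x u k + \<bar>entry G x u k\<bar> = (\<Sum>m=1..k. \<bar>entry G x u m\<bar>) + (real k - 1) * \<delta>"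
  using assms
proof (induction k rule: dec_induct)
  case (step k)
  then show ?case
    by (simp add: algebra_simps)
qed simp

theorem theorem4p10:
  fixes G :: "(nat, 'e) pre_digraph"
    and N i :: nat
    and \<epsilon> :: "nat \<Rightarrow> nat \<Rightarrow> 'e"
    and \<delta> :: real
    and x :: "real list"
    and F :: "nat \<Rightarrow> real set"
  assumes "fin_digraph G"
    and "verts G = {1..N}"
    and "strongly_conn G"
    and "\<forall>j\<in>verts G. out_degree G j \<ge> 2"
    and "edge_ordering G \<epsilon>"
    and "i \<in> verts G"
    and "circuit_avoiding G i"
    and "0 < \<delta>"
    and "\<delta> < Min ((\<lambda>j. 1 / (real (out_degree G j) - 1)) ` verts G)"
    and "x \<in> param_set G \<delta>"
    and "\<forall>j\<in>verts G - {i}. \<exists>m\<in>{1..out_degree G j - 1}. \<exists>n\<in>{1..out_degree G j - 1}.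
           \<bar>entry G x i 1\<bar> \<in> {(\<Sum>k=1..m. \<bar>entry G x j k\<bar>) + (real m - 1) * \<delta> <..<
                               (\<Sum>k=1..m. \<bar>entry G x j k\<bar>) + real m * \<delta>} \<and>
           1 - \<bar>entry G x i 1\<bar> \<in> {(\<Sum>k=1..n. \<bar>entry G x j k\<bar>) + (real n - 1) * \<delta> <..<
                                   (\<Sum>k=1..n. \<bar>entry G x j k\<bar>) + real n * \<delta>}"
    and "gd_attractors G (digamma_ifs G \<epsilon> \<delta> x) F"
  shows "\<not> (\<exists>\<Phi>. standard_ifs \<Phi> \<and> ifs_attractor \<Phi> (F i))"
proof -
  interpret fin_digraph G by fact
  define idx where "idx a = inv_into {1..out_degree G (tail G a)} (\<epsilon> (tail G a)) a" for a
  define r where "r a = entry G x (tail G a) (idx a)" for a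
  define c where "c a = offset G \<delta> x (tail G a) (idx a) - r a * (if r a < 0 then 1 else 0)" for a
  define lo where "lo u k = offset G \<delta> x u k" for u k
  define hi where "hi u k = offset G \<delta> x u k + \<bar>entry G x u k\<bar>" for u k
  have hi_sum: "hi u k = (\<Sum>m=1..k. \<bar>entry G x u m\<bar>) + (real k - 1) * \<delta>" if "1 \<le> k" for u k
    unfolding hi_def by (rule offset_eq_sum[OF that])
  have S: "digamma_ifs G \<epsilon> \<delta> x a = (\<lambda>t. r a * t + c a)" for a
    by (rule ext) (simp add: digamma_ifs_def r_def c_def idx_def Let_def)
  have pos: "0 < \<bar>entry G x u k\<bar>" if "u \<in> verts G" "k \<in> {1..out_degree G u}" for u k
    using assms(10) that unfolding param_set_def by blast
  have total: "(\<Sum>k=1..out_degree G u. \<bar>entry G x u k\<bar>) = 1 - (real (out_degree G u) - 1) * \<delta>"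
    if "u \<in> verts G" for u
    using assms(10) that unfolding param_set_def by blast
  have bij: "bij_betw (\<epsilon> u) {1..out_degree G u} (out_arcs G u)" if "u \<in> verts G" for u
    using assms(5) that unfolding edge_ordering_def by blast
  have idx: "idx (\<epsilon> u k) = k \<and> tail G (\<epsilon> u k) = u" if "u \<in> verts G" "k \<in> {1..out_degree G u}" for u k
  proof -
    have "\<epsilon> u k \<in> out_arcs G u"
      using bij[OF that(1)] that(2) by (rule bij_betwE[rule_format])
    then have "tail G (\<epsilon> u k) = u"
      by simp
    then show ?thesis
      using bij[OF that(1)] that(2) unfolding idx_def by (simp add: bij_betw_def inv_into_f_f)
  qed
  have small: "\<bar>entry G x u k\<bar> < 1" if u: "u \<in> verts G" and k: "k \<in> {1..out_degree G u}" for u k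
  proof -
    have "\<bar>entry G x u k\<bar> \<le> (\<Sum>k=1..out_degree G u. \<bar>entry G x u k\<bar>)"
      using k by (intro member_le_sum) auto
    also have "\<dots> < 1"
      using total[OF u] assms(4,8) u by fastforce
    finally show ?thesis .
  qed
  have arc_idx: "tail G a \<in> verts G \<and> idx a \<in> {1..out_degree G (tail G a)}" if "a \<in> arcs G" for a
  proof -
    have "a \<in> \<epsilon> (tail G a) ` {1..out_degree G (tail G a)}"
      using bij[of "tail G a"] that by (auto simp: bij_betw_def)
    then have "idx a \<in> {1..out_degree G (tail G a)}"
      unfolding idx_def by (rule inv_into_into)
    then show ?thesis
      using that by simp
  qed
  have by_head: "(\<Union>v\<in>verts G. \<Union>a\<in>edges_between G u v. T a v) = (\<Union>a\<in>out_arcs G u. T a (head G a))"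
    for u and T :: "'e \<Rightarrow> nat \<Rightarrow> real set"
    using head_in_verts unfolding edges_between_def out_arcs_def by blast
  interpret interval_chain_ifs G \<epsilon> r c lo hi \<delta> F
  proof unfold_locales
    fix u assume u: "u \<in> verts G"
    show "1 \<le> out_degree G u"
      using assms(4) u by fastforce
    then show "hi u (out_degree G u) = 1"
      using hi_sum[of "out_degree G u" u] total[OF u] by simp
    show "F u \<noteq> {}" "compact (F u)"
      using assms(12) u unfolding gd_attractors_def by blast+
    have "F u = (\<Union>v\<in>verts G. \<Union>a\<in>edges_between G u v. (\<lambda>t. r a * t + c a) ` F v)"
      using assms(12) u unfolding gd_attractors_def S by blast
    also have "\<dots> = (\<Union>a\<in>out_arcs G u. (\<lambda>t. r a * t + c a) ` F (head G a))"
      by (rule by_head)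
    finally show "F u = (\<Union>a\<in>out_arcs G u. (\<lambda>t. r a * t + c a) ` F (head G a))" .
    fix k assume k: "k \<in> {1..out_degree G u}"
    show "c (\<epsilon> u k) = lo u k \<and> r (\<epsilon> u k) + c (\<epsilon> u k) = hi u k \<or>
        c (\<epsilon> u k) = hi u k \<and> r (\<epsilon> u k) + c (\<epsilon> u k) = lo u k"
      using idx[OF u k] by (auto simp: c_def r_def lo_def hi_def)
  qed (use assms(5,8) pos small arc_idx in \<open>auto simp: r_def lo_def hi_def\<close>)
  have hi_1: "hi i 1 = \<bar>entry G x i 1\<bar>"
    by (simp add: hi_def)
  \<comment> \<open>the open intervals of the hypothesis are first-level gaps of \<open>F j\<close>\<close>
  have in_gap: "y \<notin> F j" if "j \<in> verts G" "m \<in> {1..out_degree G j - 1}"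
    "y \<in> {(\<Sum>k=1..m. \<bar>entry G x j k\<bar>) + (real m - 1) * \<delta> <..<
           (\<Sum>k=1..m. \<bar>entry G x j k\<bar>) + real m * \<delta>}" for y j m
  proof -
    have "1 \<le> m" "m < deg j"
      using that(2) by auto
    then show ?thesis
      using gap_misses_F[of j m y] hi_sum[of m j] that(1,3) by (auto simp: algebra_simps)
  qed
  have "hi i 1 \<notin> F j \<and> 1 - hi i 1 \<notin> F j" if "j \<in> verts G" "j \<noteq> i" for j
    using assms(11) that in_gap[OF that(1)] unfolding hi_1 by blast
  then show ?thesis
    using not_standard_attractor[OF assms(6,3,7)] by blast
qed

end
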